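(* Consider the time-of-arrival tracking setting described in the context: sensors $\bm{a}_1,\ldots,\bm{a}_m$, true positions $\bm{x}_1^\star,\ldots,\bm{x}_T^\star\in\mathcal{T}$, noise levels $\sigma_1,\ldots,\sigma_T$ with $\sigma^2=\max_t\sigma_t^2$, loss functions $f_t$ with global minimizers $\hat{\bm{x}}_t$, uniform constants $c_0,K_1,K_2,\Lambda$, and constants $\delta,\kappa,\mu,L>0$. Suppose that $$\|\bm{x}_t^\star-\bm{a}_i\|>K_1\sqrt{m}\,\sigma+K_2m\sigma^2+\delta,\quad i=1,\ldots,m;\ t=1,\ldots,T,$$ $$\kappa=\frac{\delta}{10m}\,\Lambda-(K_1\sqrt{m}\,\sigma+K_2m\sigma^2)-\frac{4c_0\sigma}{5}>0,$$ and $$\kappa\ge\frac{2(K_1\sqrt{m}\,\sigma+K_2m\sigma^2)+v}{1-\rho},$$ where $v=\max_{t\in\{1,\ldots,T-1\}}\|\bm{x}_{t+1}^\star-\bm{x}_t^\star\|$ and $\rho=\left(1-\frac{2\eta\mu L}{\mu+L}\right)^{1/2}\in(0,1)$, with $\eta\in(0,2/(\mu+L)]$. Suppose further that the initial point $\bm{x}_0\in\mathbb{R}^n$ satisfies $\|\bm{x}_0-\bm{x}_1^\star\|\le K_1\sqrt{m}\,\sigma+K_2m\sigma^2$, and let $\bm{x}_t=\bm{x}_{t-1}-\eta\nabla f_t(\bm{x}_{t-1})$ for $t=1,\ldots,T$. Then, for $t=0,1,\ldots,T-1$, the iterate $\bm{x}_t$ lies in the strong convexity region $B(\hat{\bm{x}}_{t+1},\kappa)$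 of the loss function $f_{t+1}$.
   Context: $\|\cdot\|$ is the Euclidean norm, $\lambda_{\min}$ the smallest eigenvalue of a symmetric matrix, and $B(\bar{\bm{x}},r)=\{\bm{x}\in\mathbb{R}^n:\|\bm{x}-\bar{\bm{x}}\|\le r\}$. Setting. The sensors $\bm{a}_1,\ldots,\bm{a}_m\in\mathbb{R}^n$ are such that $\{\bm{a}_i-\bm{a}_1\}_{i=2}^m$ spans $\mathbb{R}^n$. The target stays in a fixed compact set $\mathcal{T}\subseteq\mathbb{R}^n$; its true position at time $t\in\{1,\ldots,T\}$ is $\bm{x}_t^\star\in\mathcal{T}$. The range measurements are $r_i^t=\|\bm{x}_t^\star-\bm{a}_i\|+w_i^t$, where the $w_i^t$ are independent (over $i$ and $t$) real random variables with mean zero and variance at most $\sigma_t^2$ ($\sigma_t\ge0$). A realization of the noise is fixed for which, with $\bm{w}^t=(w_1^t,\ldots,w_m^t)$, $\|\bm{w}^t\|\le c_0\sqrt{m}\,\sigma_t$ for all $t$ ($c_0>0$ a constant) and $|w_i^t|\le\frac12\|\bm{x}_t^\star-\bm{a}_i\|$ for all $i,t$ (the precise form taken here of "noise small compared with distance"). Set $\sigma=\max_{1\le t\le T}\sigma_t$. The loss at time $t$ is $f_t(\bm{x})=\sum_{i=1}^m(\|\bm{x}-\bm{a}_i\|-r_i^t)^2$, and $\hat{\bm{x}}_t$ denotes a global minimizer of $f_t$ over $\mathbb{R}^n$. Uniform constants. $K_1,K_2>0$ are constants such that for every $\bm{x}^\star\in\mathcal{T}$, every $s\ge0$ and every $\bm{u}\in\mathbb{R}^m$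 with $\|\bm{u}\|\le c_0\sqrt{m}\,s$ and $|u_i|\le\frac12\|\bm{x}^\star-\bm{a}_i\|$ for all $i$, every global minimizer $\bm{z}$ of $\bm{x}\mapsto\sum_{i=1}^m(\|\bm{x}-\bm{a}_i\|-\|\bm{x}^\star-\bm{a}_i\|-u_i)^2$ satisfies $\|\bm{z}-\bm{x}^\star\|\le K_1\sqrt{m}\,s+K_2ms^2$ (in particular $\|\hat{\bm{x}}_t-\bm{x}_t^\star\|\le K_1\sqrt m\,\sigma_t+K_2m\sigma_t^2$). $\Lambda>0$ is a constant such that $\lambda_{\min}\big(\sum_{i=1}^m\frac{(\bm{x}^\star-\bm{a}_i)(\bm{x}^\star-\bm{a}_i)^T}{\|\bm{x}^\star-\bm{a}_i\|^2}\big)\ge\Lambda$ for every $\bm{x}^\star\in\mathcal{T}\setminus\{\bm{a}_1,\ldots,\bm{a}_m\}$. (Such constants exist; this may be taken as given.) Strong convexity and smoothness constants. Under the first two displayed conditions of the claim, each $f_t$ is twice continuously differentiable on $B(\hat{\bm{x}}_t,\kappa)$, and $\mu,L>0$ denote constants such that for all $t=1,\ldots,T$ and all $\bm{x},\bm{y}\in B(\hat{\bm{x}}_t,\kappa)$: $f_t(\bm{x})\ge f_t(\bm{y})+\nabla f_t(\bm{y})^T(\bm{x}-\bm{y})+\frac{\mu}{2}\|\bm{x}-\bm{y}\|^2$ and $\|\nabla f_t(\bm{y})-\nabla f_t(\bm{x})\|\le L\|\bm{x}-\bm{y}\|$. Conventions: if $T=1$, then $v=0$. The functions $f_t$ may be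 non-differentiable at the sensors $\bm{a}_i$; any convention for $\nabla f_t(\bm{a}_i)$ may be used in the update. *)

theory Defs
  imports "HOL-Probability.Probability"
begin

definition outer_product :: "real^'n \<Rightarrow> real^'n^'n"
  where "outer_product v = (columnvector v :: real^1^'n) ** (rowvector v :: real^'n^1)"

definition eigenvalue :: "real^'n^'n \<Rightarrow> real \<Rightarrow> bool"
  where "eigenvalue A c \<longleftrightarrow> (\<exists>v. v \<noteq> 0 \<and> A *v v = c *\<^sub>R v)"

text \<open>Meaningful for symmetric \<open>A\<close>, whose set of real eigenvalues is finite and nonempty.\<close>

definition lambda_min :: "real^'n^'n \<Rightarrow> real"
  where "lambda_min A = Min {c. eigenvalue A c}"

text \<open>Sensors are indexed by \<open>{1..m}\<close>; values of \<open>a\<close> and \<open>r\<close> outside this range are irrelevant.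
  Vectors in \<open>m\<close>-dimensional space are likewise functions on \<open>{1..m}\<close>, whose Euclidean norm
  is \<^const>\<open>L2_set\<close>.\<close>

definition range_loss :: "nat \<Rightarrow> (nat \<Rightarrow> real^'n) \<Rightarrow> (nat \<Rightarrow> real) \<Rightarrow> real^'n \<Rightarrow> real"
  where "range_loss m a r x = (\<Sum>i=1..m. (norm (x - a i) - r i)\<^sup>2)"

abbreviation global_minimizer :: "(real^'n \<Rightarrow> real) \<Rightarrow> real^'n \<Rightarrow> bool"
  where "global_minimizer f z \<equiv> is_arg_min f (\<lambda>_. True) z"

text \<open>\<open>g\<close> is the gradient of \<open>f\<close> where \<open>f\<close> is differentiable and an arbitrary convention elsewhere.\<close>

definition gradient_selection :: "(real^'n \<Rightarrow> real) \<Rightarrow> (real^'n \<Rightarrow> real^'n) \<Rightarrow> bool"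
  where "gradient_selection f g \<longleftrightarrow> (\<forall>x. f differentiable (at x) \<longrightarrow> (GDERIV f x :> g x))"

text \<open>Independent square-integrable centred noises, with variance at most \<open>(s t)\<^sup>2\<close> at time \<open>t\<close>.
  Square-integrability is explicit because the Bochner integral of a non-integrable function is \<open>0\<close>.\<close>

definition noise_model ::
    "'w measure \<Rightarrow> nat \<Rightarrow> nat \<Rightarrow> (nat \<Rightarrow> real) \<Rightarrow> (nat \<Rightarrow> nat \<Rightarrow> 'w \<Rightarrow> real) \<Rightarrow> bool"
  where "noise_model M m T s W \<longleftrightarrow>
    prob_space M \<and>
    prob_space.indep_vars M (\<lambda>_. borel) (\<lambda>(t, i). W t i) ({1..T} \<times> {1..m}) \<and>
    (\<forall>t\<in>{1..T}. \<forall>i\<in>{1..m}.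
       integrable M (W t i) \<and> integrable M (\<lambda>\<omega>. (W t i \<omega>)\<^sup>2) \<and>
       prob_space.expectation M (W t i) = 0 \<and>
       prob_space.variance M (W t i) \<le> (s t)\<^sup>2)"

end

theory Submission
  imports Defs
begin

text \<open>
  Write \<open>E\<close> for \<open>K1 * sqrt m * \<sigma> + K2 * m * \<sigma>\<^sup>2\<close>.  If a gradient step for \<open>f t\<close> from a point of
  \<open>cball (xhat t) \<kappa>\<close> brings the iterate closer to \<open>xhat t\<close> by the factor \<open>\<rho>\<close>, then the drift from
  \<open>xhat t\<close> to \<open>xhat (t + 1)\<close>, at most \<open>2 * E + v\<close> by passing through the true positions, leaves a
  distance of at most \<open>\<rho> * \<kappa> + 2 * E + v \<le> \<kappa>\<close>, and induction on time concludes.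

  The contraction is the substance.  Strong convexity and smoothness are available only inside
  the ball, so the textbook proof of the coercivity inequality, which evaluates the function at
  auxiliary points that may lie outside, is not applicable.  Instead, the step
  \<open>y \<mapsto> y - \<eta> *\<^sub>R grad y\<close> is viewed as the gradient \<open>G\<close> of \<open>h y = (norm y)\<^sup>2 / 2 - \<eta> * f y\<close>.
  The quadratic lower bound (strong convexity) and the quadratic upper bound on \<open>f\<close>
  (\<open>smooth_convex_upper_bound\<close>) show that \<open>h\<close> differs from its linearizations by at most
  \<open>c / 2\<close> times the squared distance, with \<open>c = 1 - \<eta> * \<mu>\<close>.  A polarization argument
  (\<open>gradient_lipschitz_from_center\<close>) turns this into \<open>norm (G x - G z) \<le> c * norm (x - z)\<close>.  It
  evaluates \<open>h\<close> only on the sphere whose diameter is the segment from the centre \<open>z\<close> to \<open>x\<close>, and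
  this sphere stays in the ball.  Finally \<open>c \<le> \<rho>\<close> for step sizes up to \<open>2 / (\<mu> + L)\<close>, and the
  gradient vanishes at the minimizer \<open>z\<close>.
\<close>

section \<open>First-order estimates\<close>

text \<open>
  Bounding \<open>f x - f y\<close> by the slope at \<open>x\<close> gives the estimate with constant \<open>L\<close> in place of
  \<open>L / 2\<close>.  If a constant \<open>C\<close> works on all of \<open>S\<close>, then applying it to both halves of a segment and
  comparing the slopes at \<open>y\<close> and at the midpoint yields \<open>C / 2 + L / 4\<close>; iterating this map
  converges to its fixed point \<open>L / 2\<close>.
\<close>

lemma smooth_convex_upper_bound:
  fixes f :: "'a::real_inner \<Rightarrow> real" and g :: "'a \<Rightarrow> 'a"
  assumes "convex S"
    and subgradient: "\<And>x y. x \<in> S \<Longrightarrow> y \<in> S \<Longrightarrow> f x \<ge> f y + g y \<bullet> (x - y)"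
    and lipschitz: "\<And>x y. x \<in> S \<Longrightarrow> y \<in> S \<Longrightarrow> norm (g x - g y) \<le> L * norm (x - y)"
    and "x \<in> S" "y \<in> S"
  shows "f x \<le> f y + g y \<bullet> (x - y) + L / 2 * (norm (x - y))\<^sup>2"
proof -
  have slope: "(g x - g y) \<bullet> e \<le> L * norm (x - y) * norm e" if "x \<in> S" "y \<in> S" for x y e
    by (meson lipschitz mult_right_mono norm_cauchy_schwarz norm_ge_zero order_trans that)
  have bisected: "f x \<le> f y + g y \<bullet> (x - y) + (L / 2 + L / 2 * (1/2) ^ k) * (norm (x - y))\<^sup>2"
    if "x \<in> S" "y \<in> S" for k x y
    using that
  proof (induction k arbitrary: x y)
    case 0
    have "f x \<le> f y + g x \<bullet> (x - y)"
      using subgradient[of y x] 0 by (simp add: inner_diff_right)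
    moreover have "(g x - g y) \<bullet> (x - y) \<le> L * (norm (x - y))\<^sup>2"
      using slope[of x y "x - y"] 0 by (simp add: power2_eq_square mult.assoc)
    ultimately show ?case by (simp add: inner_diff_left)
  next
    case (Suc k)
    define d where "d = (1/2) *\<^sub>R (x - y)"
    define p where "p = y + d"
    have x_p: "x - p = d" and p_y: "p - y = d" and x_y: "x - y = d + d"
      by (simp_all add: p_def d_def algebra_simps flip: scaleR_add_left)
    have "p = (1/2) *\<^sub>R y + (1/2) *\<^sub>R x"
      by (simp add: p_def d_def algebra_simps flip: scaleR_add_left)
    then have "p \<in> S"
      using \<open>convex S\<close> Suc.prems by (simp add: convex_def)
    define C where "C = L / 2 + L / 2 * (1/2) ^ k"
    have "f x \<le> f p + g p \<bullet> d + C * (norm d)\<^sup>2"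
      using Suc.IH[OF Suc.prems(1) \<open>p \<in> S\<close>] by (simp add: x_p C_def)
    moreover have "f p \<le> f y + g y \<bullet> d + C * (norm d)\<^sup>2"
      using Suc.IH[OF \<open>p \<in> S\<close> Suc.prems(2)] by (simp add: p_y C_def)
    moreover have "g p \<bullet> d - g y \<bullet> d \<le> L * (norm d)\<^sup>2"
      using slope[OF \<open>p \<in> S\<close> Suc.prems(2), of d]
      by (simp add: p_y power2_eq_square inner_diff_left mult.assoc)
    ultimately have "f x \<le> f y + g y \<bullet> (d + d) + (2 * C + L) * (norm d)\<^sup>2"
      by (simp add: inner_add_right algebra_simps)
    also have "(2 * C + L) * (norm d)\<^sup>2 = (C / 2 + L / 4) * (norm (d + d))\<^sup>2"
      by (simp add: algebra_simps flip: scaleR_2)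
    also have "C / 2 + L / 4 = L / 2 + L / 2 * (1/2) ^ Suc k"
      by (simp add: C_def field_simps)
    finally show ?case by (simp add: x_y)
  qed
  have "(\<lambda>k. f y + g y \<bullet> (x - y) + (L / 2 + L / 2 * (1/2) ^ k) * (norm (x - y))\<^sup>2)
      \<longlonglongrightarrow> f y + g y \<bullet> (x - y) + (L / 2 + L / 2 * 0) * (norm (x - y))\<^sup>2"
    by (intro tendsto_intros LIMSEQ_power_zero) simp
  then have "f x \<le> f y + g y \<bullet> (x - y) + (L / 2 + L / 2 * 0) * (norm (x - y))\<^sup>2"
    by (rule LIMSEQ_le_const) (use bisected assms(4,5) in blast)
  then show ?thesis by simp
qed

text \<open>
  Moving from \<open>z\<close> by \<open>- s *\<^sub>R d\<close> for small \<open>s > 0\<close> would decrease \<open>f\<close>, since the gain is linear in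
  \<open>s\<close> and the error quadratic.
\<close>

lemma slope_zero_at_minimizer:
  fixes f :: "'a::real_inner \<Rightarrow> real"
  assumes "r > 0" "L > 0"
    and minimal: "\<And>x. f z \<le> f x"
    and upper: "\<And>x. x \<in> cball z r \<Longrightarrow> f x \<le> f z + d \<bullet> (x - z) + L / 2 * (norm (x - z))\<^sup>2"
  shows "d = 0"
proof (rule ccontr)
  assume "d \<noteq> 0"
  \<comment> \<open>The first bound keeps the point in the ball, the second makes the linear term win.\<close>
  define s where "s = min (r / norm d) (1 / L)"
  have "s > 0" "s * norm d \<le> r" "s * L \<le> 1"
    using \<open>d \<noteq> 0\<close> assms(1,2) by (auto simp: s_def min_def field_simps)
  then have "z - s *\<^sub>R d \<in> cball z r"
    by (simp add: dist_norm)
  from upper[OF this] minimal[of "z - s *\<^sub>R d"]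
  have "s * (norm d)\<^sup>2 \<le> L / 2 * (s * norm d)\<^sup>2"
    using \<open>s > 0\<close> by (simp add: power2_norm_eq_inner power_mult_distrib)
  also have "\<dots> = (s * L) / 2 * (s * (norm d)\<^sup>2)"
    by (simp add: power2_eq_square)
  also have "\<dots> \<le> 1 / 2 * (s * (norm d)\<^sup>2)"
    using \<open>s > 0\<close> \<open>s * L \<le> 1\<close> by (intro mult_right_mono) auto
  finally show False
    using \<open>s > 0\<close> \<open>d \<noteq> 0\<close> by simp
qed

section \<open>Contraction of a gradient step towards the minimizer\<close>

text \<open>
  This is the nonlinear form of the fact that a symmetric operator whose quadratic form is bounded
  by \<open>c\<close> has norm at most \<open>c\<close>.  Let \<open>p\<close> be the midpoint of \<open>z\<close> and \<open>x\<close> and \<open>d\<close> half of \<open>x - z\<close>.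
  Estimating \<open>h (p + e) - h (p - e)\<close> from below by linearizing at \<open>x\<close> and from above by linearizing
  at \<open>z\<close> bounds \<open>(G x - G z) \<bullet> e\<close>; the best \<open>e\<close> of length \<open>norm d\<close> is parallel to \<open>G x - G z\<close>.
  Both \<open>p + e\<close> and \<open>p - e\<close> lie on the sphere with diameter from \<open>z\<close> to \<open>x\<close>, hence in the ball
  because \<open>z\<close> is its centre.
\<close>

lemma gradient_lipschitz_from_center:
  fixes h :: "'a::real_inner \<Rightarrow> real" and G :: "'a \<Rightarrow> 'a"
  assumes linearization: "\<And>x y. x \<in> cball z r \<Longrightarrow> y \<in> cball z r \<Longrightarrow>
             \<bar>h x - h y - G y \<bullet> (x - y)\<bar> \<le> c / 2 * (norm (x - y))\<^sup>2"
    and x: "x \<in> cball z r"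
  shows "norm (G x - G z) \<le> c * norm (x - z)"
proof (cases "G x = G z \<or> x = z")
  case True
  have "0 \<le> c * (norm (x - z))\<^sup>2"
    using order_trans[OF abs_ge_zero linearization[of x z]] x
      order_trans[OF zero_le_dist x[unfolded mem_cball]] by simp
  with True show ?thesis
    by (auto simp: zero_le_mult_iff)
next
  case False
  define D where "D = G x - G z"
  define d where "d = (1/2) *\<^sub>R (x - z)"
  define p where "p = z + d"
  define e where "e = (norm d / norm D) *\<^sub>R D"
  have "D \<noteq> 0" "d \<noteq> 0"
    using False by (auto simp: D_def d_def)
  then have norm_e: "norm e = norm d"
    by (simp add: e_def)
  have "norm (x - z) = 2 * norm d"
    by (simp add: d_def)
  then have r: "2 * norm d \<le> r"
    using x by (simp add: dist_norm norm_minus_commute)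
  have z: "z \<in> cball z r"
    using order_trans[OF zero_le_dist x[unfolded mem_cball]] by simp
  have "norm (d + e) \<le> r" "norm (d - e) \<le> r"
    using norm_triangle_ineq[of d e] norm_triangle_ineq4[of d e] norm_e r by auto
  then have plus: "p + e \<in> cball z r" and minus: "p - e \<in> cball z r"
    unfolding mem_cball p_def dist_commute[of z] by (simp_all add: dist_norm add.assoc flip: add_diff_eq)
  have x_eq: "x = p + d"
    by (simp add: p_def d_def algebra_simps flip: scaleR_add_left)
  have parallelogram: "(norm (e + d))\<^sup>2 + (norm (e - d))\<^sup>2 = 4 * (norm d)\<^sup>2"
    using norm_e by (simp add: power2_norm_eq_inner inner_simps inner_commute norm_eq)
  have from_x: "p + e - x = e - d" "p - e - x = - (e + d)"
    and from_z: "p + e - z = e + d" "p - e - z = - (e - d)"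
    by (simp_all add: x_eq p_def)
  have "G x \<bullet> (e - d) - c / 2 * (norm (e - d))\<^sup>2 \<le> h (p + e) - h x"
    using linearization[OF plus x] unfolding from_x abs_le_iff by linarith
  moreover have "h (p - e) - h x \<le> - (G x \<bullet> (e + d)) + c / 2 * (norm (e + d))\<^sup>2"
    using linearization[OF minus x]
    unfolding from_x abs_le_iff inner_minus_right norm_minus_cancel by linarith
  moreover have "h (p + e) - h z \<le> G z \<bullet> (e + d) + c / 2 * (norm (e + d))\<^sup>2"
    using linearization[OF plus z] unfolding from_z abs_le_iff by linarith
  moreover have "- (G z \<bullet> (e - d)) - c / 2 * (norm (e - d))\<^sup>2 \<le> h (p - e) - h z"
    using linearization[OF minus z]
    unfolding from_z abs_le_iff inner_minus_right norm_minus_cancel by linarith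
  ultimately have "2 * (D \<bullet> e) \<le> c * ((norm (e + d))\<^sup>2 + (norm (e - d))\<^sup>2)"
    by (simp add: D_def inner_simps algebra_simps)
  moreover have "D \<bullet> e = norm D * norm d"
    using \<open>D \<noteq> 0\<close> by (simp add: e_def power2_eq_square flip: power2_norm_eq_inner)
  ultimately have "norm D * norm d \<le> (c * (2 * norm d)) * norm d"
    unfolding parallelogram by (simp add: power2_eq_square)
  then show ?thesis
    using \<open>d \<noteq> 0\<close> \<open>norm (x - z) = 2 * norm d\<close> by (simp add: D_def)
qed

text \<open>
  The linearization error of \<open>h\<close> lies between \<open>(1 - \<eta> * L) / 2\<close> and \<open>(1 - \<eta> * \<mu>) / 2\<close> times
  the squared distance; the step size bound makes the upper of these dominate in absolute value.
\<close>

lemma gradient_step_contraction: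
  fixes f :: "'a::real_inner \<Rightarrow> real" and g :: "'a \<Rightarrow> 'a"
  assumes "r > 0" "\<mu> > 0" "L > 0"
    and strong_convexity: "\<And>x y. x \<in> cball z r \<Longrightarrow> y \<in> cball z r \<Longrightarrow>
             f x \<ge> f y + g y \<bullet> (x - y) + \<mu> / 2 * (norm (x - y))\<^sup>2"
    and lipschitz: "\<And>x y. x \<in> cball z r \<Longrightarrow> y \<in> cball z r \<Longrightarrow>
             norm (g x - g y) \<le> L * norm (x - y)"
    and minimal: "\<And>x. f z \<le> f x"
    and "0 < \<eta>" "\<eta> \<le> 2 / (\<mu> + L)"
    and x: "x \<in> cball z r"
  shows "norm (x - \<eta> *\<^sub>R g x - z) \<le> (1 - \<eta> * \<mu>) * norm (x - z)"
proof -
  have upper: "f x \<le> f y + g y \<bullet> (x - y) + L / 2 * (norm (x - y))\<^sup>2"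
    if "x \<in> cball z r" "y \<in> cball z r" for x y
  proof (rule smooth_convex_upper_bound[OF convex_cball _ lipschitz that])
    show "f x \<ge> f y + g y \<bullet> (x - y)" if "x \<in> cball z r" "y \<in> cball z r" for x y
      using strong_convexity[OF that] \<open>\<mu> > 0\<close>
      by (smt (verit) divide_pos_pos mult_nonneg_nonneg zero_le_power2)
  qed
  have "g z = 0"
  proof (rule slope_zero_at_minimizer[where f = f and z = z, OF \<open>r > 0\<close> \<open>L > 0\<close> minimal])
    show "f x \<le> f z + g z \<bullet> (x - z) + L / 2 * (norm (x - z))\<^sup>2" if "x \<in> cball z r" for x
      using upper[OF that] \<open>r > 0\<close> by simp
  qed
  define h where "h y = (norm y)\<^sup>2 / 2 - \<eta> * f y" for y
  define G where "G y = y - \<eta> *\<^sub>R g y" for y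
  have "\<bar>h x - h y - G y \<bullet> (x - y)\<bar> \<le> (1 - \<eta> * \<mu>) / 2 * (norm (x - y))\<^sup>2"
    if "x \<in> cball z r" "y \<in> cball z r" for x y
  proof -
    define B where "B = f x - f y - g y \<bullet> (x - y)"
    define N where "N = (norm (x - y))\<^sup>2"
    have eq: "h x - h y - G y \<bullet> (x - y) = N / 2 - \<eta> * B"
      by (simp add: h_def G_def B_def N_def power2_norm_eq_inner inner_simps inner_commute field_simps)
    have "\<eta> * (\<mu> / 2 * N) \<le> \<eta> * B" "\<eta> * B \<le> \<eta> * (L / 2 * N)"
      using strong_convexity[OF that] upper[OF that] \<open>0 < \<eta>\<close>
      by (simp_all add: B_def N_def)
    \<comment> \<open>Equivalently, \<open>1 - \<eta> * L\<close> is at least \<open>- (1 - \<eta> * \<mu>)\<close>.\<close>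
    moreover have "\<eta> * (\<mu> + L) * N \<le> 2 * N"
      using \<open>\<eta> \<le> 2 / (\<mu> + L)\<close> \<open>\<mu> > 0\<close> \<open>L > 0\<close>
      by (intro mult_right_mono) (auto simp: N_def field_simps)
    ultimately show ?thesis
      unfolding eq N_def[symmetric] abs_le_iff by (simp add: field_simps)
  qed
  from gradient_lipschitz_from_center[of z r h G, OF this x] show ?thesis
    by (simp add: G_def \<open>g z = 0\<close>)
qed

text \<open>
  The square of the right-hand side exceeds that of the left by
  \<open>\<eta> * \<mu>\<^sup>2 * (2 / (\<mu> + L) - \<eta>)\<close>, which is nonnegative by the step size bound.
\<close>

lemma contraction_factor_le:
  fixes \<mu> L \<eta> :: real
  assumes "\<mu> > 0" "L > 0" "0 < \<eta>" "\<eta> \<le> 2 / (\<mu> + L)"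
  shows "1 - \<eta> * \<mu> \<le> sqrt (1 - 2 * \<eta> * \<mu> * L / (\<mu> + L))"
proof (rule real_le_rsqrt)
  have "(1 - 2 * \<eta> * \<mu> * L / (\<mu> + L)) - (1 - \<eta> * \<mu>)\<^sup>2 = \<eta> * \<mu>\<^sup>2 * (2 / (\<mu> + L) - \<eta>)"
    using assms(1,2) by (simp add: field_simps power2_eq_square)
  moreover have "\<eta> * \<mu>\<^sup>2 * (2 / (\<mu> + L) - \<eta>) \<ge> 0"
    using assms by simp
  ultimately show "(1 - \<eta> * \<mu>)\<^sup>2 \<le> 1 - 2 * \<eta> * \<mu> * L / (\<mu> + L)"
    by linarith
qed

section \<open>Tracking the moving minimizer\<close>

theorem proposition2:
  fixes a :: "nat \<Rightarrow> real^'n" and m T :: nat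
    and \<T> :: "(real^'n) set" and xstar xhat x :: "nat \<Rightarrow> real^'n"
    and M :: "'w measure" and W :: "nat \<Rightarrow> nat \<Rightarrow> 'w \<Rightarrow> real" and \<omega> :: 'w
    and w r :: "nat \<Rightarrow> nat \<Rightarrow> real"
    and s :: "nat \<Rightarrow> real"
    and f :: "nat \<Rightarrow> real^'n \<Rightarrow> real" and grad_f :: "nat \<Rightarrow> real^'n \<Rightarrow> real^'n"
    and \<sigma> c0 K1 K2 \<Lambda> \<delta> \<kappa> \<mu> L \<eta> \<rho> v :: real
  assumes T_pos: "T \<ge> 1"
    and sensors_span: "span {a i - a 1 |i. i \<in> {2..m}} = UNIV"
    and target_compact: "compact \<T>"
    and target_in: "\<And>t. t \<in> {1..T} \<Longrightarrow> xstar t \<in> \<T>"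
    \<comment> \<open>noise and its fixed realization\<close>
    and s_nonneg: "\<And>t. t \<in> {1..T} \<Longrightarrow> s t \<ge> 0"
    and noise: "noise_model M m T s W"
    and realization: "\<omega> \<in> space M" "\<And>t i. w t i = W t i \<omega>"
    and c0_pos: "c0 > 0"
    and noise_norm: "\<And>t. t \<in> {1..T} \<Longrightarrow> L2_set (w t) {1..m} \<le> c0 * sqrt (real m) * s t"
    and noise_small: "\<And>t i. t \<in> {1..T} \<Longrightarrow> i \<in> {1..m} \<Longrightarrow>
           \<bar>w t i\<bar> \<le> 1/2 * norm (xstar t - a i)"
    and sigma: "\<sigma> = Max (s ` {1..T})"
    \<comment> \<open>measurements, losses and their global minimizers\<close>
    and measurements: "\<And>t i. r t i = norm (xstar t - a i) + w t i"
    and loss: "\<And>t. f t = range_loss m a (r t)"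
    and minimizers: "\<And>t. t \<in> {1..T} \<Longrightarrow> global_minimizer (f t) (xhat t)"
    and gradients: "\<And>t. t \<in> {1..T} \<Longrightarrow> gradient_selection (f t) (grad_f t)"
    \<comment> \<open>uniform constants\<close>
    and K_pos: "K1 > 0" "K2 > 0"
    and K_bound: "\<And>y \<tau> u z. y \<in> \<T> \<Longrightarrow> \<tau> \<ge> 0 \<Longrightarrow>
           L2_set u {1..m} \<le> c0 * sqrt (real m) * \<tau> \<Longrightarrow>
           (\<forall>i\<in>{1..m}. \<bar>u i\<bar> \<le> 1/2 * norm (y - a i)) \<Longrightarrow>
           global_minimizer (\<lambda>x. \<Sum>i=1..m. (norm (x - a i) - norm (y - a i) - u i)\<^sup>2) z \<Longrightarrow>
           norm (z - y) \<le> K1 * sqrt (real m) * \<tau> + K2 * real m * \<tau>\<^sup>2"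
    and Lambda_pos: "\<Lambda> > 0"
    and Lambda_bound: "\<And>y. y \<in> \<T> - a ` {1..m} \<Longrightarrow>
           lambda_min (\<Sum>i=1..m. (1 / (norm (y - a i))\<^sup>2) *\<^sub>R outer_product (y - a i)) \<ge> \<Lambda>"
    \<comment> \<open>conditions of the claim\<close>
    and delta_pos: "\<delta> > 0"
    and separation: "\<And>t i. t \<in> {1..T} \<Longrightarrow> i \<in> {1..m} \<Longrightarrow>
           norm (xstar t - a i) > K1 * sqrt (real m) * \<sigma> + K2 * real m * \<sigma>\<^sup>2 + \<delta>"
    and kappa: "\<kappa> = \<delta> / (10 * real m) * \<Lambda>
                     - (K1 * sqrt (real m) * \<sigma> + K2 * real m * \<sigma>\<^sup>2) - 4 * c0 * \<sigma> / 5"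
           "\<kappa> > 0"
    and mu_L_pos: "\<mu> > 0" "L > 0"
    and strong_convexity: "\<And>t x y. t \<in> {1..T} \<Longrightarrow>
           x \<in> cball (xhat t) \<kappa> \<Longrightarrow> y \<in> cball (xhat t) \<kappa> \<Longrightarrow>
           f t x \<ge> f t y + grad_f t y \<bullet> (x - y) + \<mu> / 2 * (norm (x - y))\<^sup>2"
    and smoothness: "\<And>t x y. t \<in> {1..T} \<Longrightarrow>
           x \<in> cball (xhat t) \<kappa> \<Longrightarrow> y \<in> cball (xhat t) \<kappa> \<Longrightarrow>
           norm (grad_f t y - grad_f t x) \<le> L * norm (x - y)"
    and v: "v = (if T = 1 then 0 else Max ((\<lambda>t. norm (xstar (t + 1) - xstar t)) ` {1..T - 1}))"
    and eta: "\<eta> \<in> {0<..2 / (\<mu> + L)}"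
    and rho: "\<rho> = sqrt (1 - 2 * \<eta> * \<mu> * L / (\<mu> + L))" "\<rho> \<in> {0<..<1}"
    and kappa_ge: "\<kappa> \<ge> (2 * (K1 * sqrt (real m) * \<sigma> + K2 * real m * \<sigma>\<^sup>2) + v) / (1 - \<rho>)"
    \<comment> \<open>online gradient descent\<close>
    and initial: "norm (x 0 - xstar 1) \<le> K1 * sqrt (real m) * \<sigma> + K2 * real m * \<sigma>\<^sup>2"
    and update: "\<And>t. t \<in> {1..T} \<Longrightarrow> x t = x (t - 1) - \<eta> *\<^sub>R grad_f t (x (t - 1))"
  shows "\<forall>t\<in>{0..T - 1}. x t \<in> cball (xhat (t + 1)) \<kappa>"
proof -
  define E where "E = K1 * sqrt (real m) * \<sigma> + K2 * real m * \<sigma>\<^sup>2"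
  have estimate: "norm (xhat t - xstar t) \<le> E" if t: "t \<in> {1..T}" for t
  proof -
    have "s t \<le> \<sigma>"
      using t by (simp add: sigma)
    have "f t = (\<lambda>x. \<Sum>i=1..m. (norm (x - a i) - norm (xstar t - a i) - w t i)\<^sup>2)"
      unfolding loss range_loss_def measurements by (simp only: diff_diff_eq)
    then have "norm (xhat t - xstar t) \<le> K1 * sqrt (real m) * s t + K2 * real m * (s t)\<^sup>2"
      using minimizers[OF t] noise_small[OF t]
      by (intro K_bound[OF target_in[OF t] s_nonneg[OF t] noise_norm[OF t]]) simp_all
    also have "\<dots> \<le> E"
      unfolding E_def using K_pos \<open>s t \<le> \<sigma>\<close> s_nonneg[OF t]
      by (intro add_mono mult_left_mono power_mono) auto
    finally show ?thesis .
  qed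
  have drift: "norm (xstar (t + 1) - xstar t) \<le> v" if "t \<in> {1..T - 1}" for t
    using that by (auto simp: v intro!: Max_ge)
  have "v \<ge> 0"
  proof (cases "T = 1")
    case False
    then show ?thesis
      using order_trans[OF norm_ge_zero drift[of 1]] T_pos by simp
  qed (simp add: v)
  have "E \<ge> 0"
    using order_trans[OF norm_ge_zero estimate[of 1]] T_pos by simp
  have "0 \<le> \<rho>" "\<rho> < 1"
    using rho(2) by auto
  have room: "\<rho> * \<kappa> + 2 * E + v \<le> \<kappa>"
    using kappa_ge \<open>\<rho> < 1\<close> unfolding E_def[symmetric] by (simp add: field_simps)
  have "norm (x t - xhat (t + 1)) \<le> \<kappa>" if "t \<le> T - 1" for t
    using that
  proof (induction t)
    case 0
    have "norm (x 0 - xhat 1) \<le> norm (x 0 - xstar 1) + norm (xhat 1 - xstar 1)"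
      using norm_triangle_ineq4[of "x 0 - xstar 1" "xhat 1 - xstar 1"] by simp
    also have "\<dots> \<le> 2 * E"
      using initial estimate[of 1] T_pos by (simp add: E_def)
    also have "\<dots> \<le> \<kappa>"
      using room \<open>0 \<le> \<rho>\<close> \<open>\<kappa> > 0\<close> \<open>v \<ge> 0\<close> by (smt (verit) mult_nonneg_nonneg)
    finally show ?case by simp
  next
    case (Suc t)
    then have t: "t + 1 \<in> {1..T}" "t + 2 \<in> {1..T}" "t + 1 \<in> {1..T - 1}"
      by auto
    have prev: "norm (x t - xhat (t + 1)) \<le> \<kappa>"
      using Suc by simp
    have "norm (x t - \<eta> *\<^sub>R grad_f (t + 1) (x t) - xhat (t + 1))
        \<le> (1 - \<eta> * \<mu>) * norm (x t - xhat (t + 1))"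
    proof (rule gradient_step_contraction[OF kappa(2) mu_L_pos])
      show "norm (grad_f (t + 1) x - grad_f (t + 1) y) \<le> L * norm (x - y)"
        if "x \<in> cball (xhat (t + 1)) \<kappa>" "y \<in> cball (xhat (t + 1)) \<kappa>" for x y
        using smoothness[OF t(1) that(2,1)] by (simp add: norm_minus_commute)
      show "f (t + 1) (xhat (t + 1)) \<le> f (t + 1) y" for y
        using minimizers[OF t(1)] by (simp add: is_arg_min_linorder)
      show "x t \<in> cball (xhat (t + 1)) \<kappa>"
        using prev by (simp add: dist_norm norm_minus_commute)
    qed (use strong_convexity[OF t(1)] eta in auto)
    also have "\<dots> \<le> \<rho> * norm (x t - xhat (t + 1))"
      unfolding rho(1) using contraction_factor_le[OF mu_L_pos] eta
      by (intro mult_right_mono) auto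
    also have "\<dots> \<le> \<rho> * \<kappa>"
      using prev \<open>0 \<le> \<rho>\<close> by (rule mult_left_mono)
    finally have step: "norm (x (t + 1) - xhat (t + 1)) \<le> \<rho> * \<kappa>"
      using update[OF t(1)] by simp
    have "norm (x (t + 1) - xhat (t + 2)) = norm ((x (t + 1) - xhat (t + 1))
        + (xhat (t + 1) - xstar (t + 1)) - (xstar (t + 2) - xstar (t + 1))
        - (xhat (t + 2) - xstar (t + 2)))"
      by (simp add: algebra_simps)
    also have "\<dots> \<le> norm (x (t + 1) - xhat (t + 1)) + norm (xhat (t + 1) - xstar (t + 1))
        + norm (xstar (t + 2) - xstar (t + 1)) + norm (xhat (t + 2) - xstar (t + 2))"
      by (intro order_trans[OF norm_triangle_ineq4] add_mono norm_triangle_ineq order_refl)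
    also have "\<dots> \<le> \<rho> * \<kappa> + E + v + E"
      using step estimate[OF t(1)] estimate[OF t(2)] drift[OF t(3)]
      by (intro add_mono) simp_all
    also have "\<dots> \<le> \<kappa>"
      using room by simp
    finally show ?case by simp
  qed
  then show ?thesis
    by (simp add: dist_norm norm_minus_commute)
qed

end
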